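(* Let $\alpha\ge-\frac12$, $d_\alpha=2\alpha+2$, $1\le p,q\le\infty$, $0\le\beta<d_\alpha$ with $\frac1q=\frac1p-\frac{\beta}{d_\alpha}$, and $s=\frac{d_\alpha}{d_\alpha-\beta}$. Let $\psi$ be a measurable function on $\mathbb{R}$ such that $$C_{\psi,s,q,\alpha}=\left(\int_{\mathbb{R}}|\psi(z)|^s\,|z|^{s\left(\frac{d_\alpha}{q}-(2\alpha+1)\right)-1}\,dz\right)^{1/s}<\infty .$$ Then the fractional Dunkl-type Hausdorff operator $\mathcal{H}_{\psi,\beta}^\alpha$ is bounded from $L^p(\mathbb{R},d\mu_\alpha)$ to $L^q(\mathbb{R},d\mu_\alpha)$.
   Context: $d\mu_\alpha(x)=A_\alpha|x|^{2\alpha+1}dx$ with $A_\alpha=(2^{\alpha+1}\Gamma(\alpha+1))^{-1}$, and $L^p(\mathbb{R},d\mu_\alpha)$ is the usual Lebesgue space for this measure. The fractional Dunkl-type Hausdorff operator is $$\mathcal{H}_{\psi,\beta}^\alpha f(x):=\frac{1}{|x|^{2\alpha+1}}\int_{\mathbb{R}}\frac{\psi(xz^{-1})}{|z|^{1-\beta}}f(z)\,d\mu_\alpha(z),\qquad x\in\mathbb{R}\setminus\{0\}$$ (the paper introduces it for $\psi\in L^1(\mathbb{R})$ and uses the same formula for measurable $\psi$). *)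

theory Defs
  imports "HOL-Analysis.Analysis" "HOL-Probability.Essential_Supremum"
begin

text \<open>The power \<open>x\<^sup>t\<close> of an extended nonnegative number; it is only meant for exponents \<open>t > 0\<close>,
  where \<open>0\<close> is sent to \<open>0\<close> and \<open>\<infinity>\<close> to \<open>\<infinity>\<close>.\<close>

definition ennreal_powr :: "ennreal \<Rightarrow> real \<Rightarrow> ennreal" where
  "ennreal_powr x t = (if x = \<infinity> then \<infinity> else ennreal (enn2real x powr t))"

text \<open>The \<open>L\<^sup>p\<close> norm for \<open>1 \<le> p \<le> \<infinity>\<close>. The exponent is an \<^typ>\<open>ereal\<close> (with \<open>1 / \<infinity> = 0\<close>) and not an
  \<^typ>\<open>ennreal\<close>, because subtraction of reciprocals would be truncated at \<open>0\<close> in the latter.\<close>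

definition Lp_norm :: "'a measure \<Rightarrow> ereal \<Rightarrow> ('a \<Rightarrow> complex) \<Rightarrow> ennreal" where
  "Lp_norm M p f =
     (if p = \<infinity> then esssup M (\<lambda>x. ennreal (cmod (f x)))
      else ennreal_powr (\<integral>\<^sup>+x. ennreal (cmod (f x) powr real_of_ereal p) \<partial>M) (1 / real_of_ereal p))"

definition Lp_space :: "'a measure \<Rightarrow> ereal \<Rightarrow> ('a \<Rightarrow> complex) set" where
  "Lp_space M p = {f \<in> borel_measurable M. Lp_norm M p f < \<infinity>}"

definition bounded_Lp_Lq ::
  "'a measure \<Rightarrow> ereal \<Rightarrow> 'b measure \<Rightarrow> ereal \<Rightarrow> (('a \<Rightarrow> complex) \<Rightarrow> 'b \<Rightarrow> complex) \<Rightarrow> bool" where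
  "bounded_Lp_Lq M p N q T \<longleftrightarrow>
     (\<exists>C::real. 0 \<le> C \<and> (\<forall>f \<in> Lp_space M p.
        T f \<in> Lp_space N q \<and> Lp_norm N q (T f) \<le> ennreal C * Lp_norm M p f))"

definition dunkl_A :: "real \<Rightarrow> real" where
  "dunkl_A \<alpha> = 1 / (2 powr (\<alpha> + 1) * Gamma (\<alpha> + 1))"

definition dunkl_measure :: "real \<Rightarrow> real measure" where
  "dunkl_measure \<alpha> =
     density lebesgue (\<lambda>x. ennreal (dunkl_A \<alpha> * \<bar>x\<bar> powr (2 * \<alpha> + 1)))"

definition hausdorff_integrand ::
  "(real \<Rightarrow> complex) \<Rightarrow> real \<Rightarrow> (real \<Rightarrow> complex) \<Rightarrow> real \<Rightarrow> real \<Rightarrow> complex" where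
  "hausdorff_integrand \<psi> \<beta> f x z = \<psi> (x / z) / complex_of_real (\<bar>z\<bar> powr (1 - \<beta>)) * f z"

text \<open>The Bochner integral is \<open>0\<close> where the integrand is not integrable, so convergence of the
  integral has to be stated separately. The operator is defined for \<open>x \<noteq> 0\<close>; the
  value \<open>0\<close> obtained at \<open>x = 0\<close> is irrelevant, as \<open>{0}\<close> is a null set.\<close>

definition dunkl_hausdorff ::
  "real \<Rightarrow> (real \<Rightarrow> complex) \<Rightarrow> real \<Rightarrow> (real \<Rightarrow> complex) \<Rightarrow> real \<Rightarrow> complex" where
  "dunkl_hausdorff \<alpha> \<psi> \<beta> f x =
     complex_of_real (1 / \<bar>x\<bar> powr (2 * \<alpha> + 1)) *
       (\<integral>z. hausdorff_integrand \<psi> \<beta> f x z \<partial>dunkl_measure \<alpha>)"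

text \<open>In \<open>hausdorff_const \<alpha> \<psi> s q\<close>, the quotient \<open>d\<^sub>\<alpha> / q\<close> is taken in \<^typ>\<open>ereal\<close> so that
  it is \<open>0\<close> for \<open>q = \<infinity>\<close>.\<close>

definition hausdorff_const :: "real \<Rightarrow> (real \<Rightarrow> complex) \<Rightarrow> real \<Rightarrow> ereal \<Rightarrow> ennreal" where
  "hausdorff_const \<alpha> \<psi> s q =
     ennreal_powr
       (\<integral>\<^sup>+z. ennreal (cmod (\<psi> z) powr s *
          \<bar>z\<bar> powr (s * (real_of_ereal (ereal (2 * \<alpha> + 2) / q) - (2 * \<alpha> + 1)) - 1)) \<partial>lebesgue)
       (1 / s)"

end

theory Submission
  imports Defs
begin

text \<open>With \<open>F z = |f z| |z| powr (d / p)\<close> and \<open>k u = |\<psi> u| |u| powr (d / q - (2\<alpha> + 1))\<close>, the function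
  \<open>|x| powr (d / q) |H f x|\<close> is bounded by \<open>A\<^sub>\<alpha>\<close> times the convolution of \<open>k\<close> and \<open>F\<close> on the
  multiplicative group \<open>\<real> - {0}\<close> with its Haar measure \<open>dz / |z|\<close>. The claim is thus Young's inequality
  on this group, with operator bound \<open>A\<^sub>\<alpha> powr (1 / s)\<close> times the \<open>L\<^sup>s\<close> norm of \<open>k\<close>. Since \<open>\<psi>\<close> and \<open>f\<close>
  are only Lebesgue measurable, they are first replaced by Borel functions equal to them almost everywhere,
  so that Tonelli applies to the product of Borel measures; this does not change the operator at any
  point.\<close>

subsection \<open>Hoelder's inequality for three functions\<close>

text \<open>Concavity of \<open>ln\<close>: each logarithm lies below the tangent at the weighted
  mean \<open>c\<close>, and the weighted linear terms of the tangents cancel. If some argument is 0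
  the left side vanishes, even for exponent 0, because \<open>0 powr 0 = 0\<close>.\<close>

lemma weighted_AM_GM3:
  fixes u v w l m n :: real
  assumes "0 \<le> u" "0 \<le> v" "0 \<le> w" "0 \<le> l" "0 \<le> m" "0 \<le> n" "l + m + n = 1"
  shows "u powr l * v powr m * w powr n \<le> l * u + m * v + n * w"
proof (cases "u = 0 \<or> v = 0 \<or> w = 0")
  case True
  then show ?thesis using assms by auto
next
  case False
  define c where "c = l * u + m * v + n * w"
  have pos: "u > 0" "v > 0" "w > 0" using False assms by auto
  have "l > 0 \<or> m > 0 \<or> n > 0" using assms by linarith
  then have c: "c > 0"
    unfolding c_def using pos assms by (smt (verit) mult_nonneg_nonneg mult_pos_pos)
  have *: "ln y \<le> ln c + (y / c - 1)" if "y > 0" for y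
    using ln_le_minus_one[of "y / c"] that c by (simp add: ln_div)
  have "l * ln u + m * ln v + n * ln w
      \<le> l * (ln c + (u / c - 1)) + m * (ln c + (v / c - 1)) + n * (ln c + (w / c - 1))"
    using pos assms * by (intro add_mono mult_left_mono) auto
  also have "\<dots> = (l + m + n) * (ln c - 1) + (l * u + m * v + n * w) / c"
    by (simp add: algebra_simps add_divide_distrib)
  also have "(l * u + m * v + n * w) / c = 1"
    using c by (simp add: c_def)
  also have "(l + m + n) * (ln c - 1) + 1 = ln c" using assms(7) by simp
  finally have "exp (l * ln u + m * ln v + n * ln w) \<le> c"
    using c by (simp add: ln_ge_iff)
  then show ?thesis
    using pos by (simp add: powr_def exp_add c_def)
qed

lemma nn_integral_Holder3:
  fixes u v w :: "'a \<Rightarrow> real"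
  assumes [measurable]: "u \<in> borel_measurable M" "v \<in> borel_measurable M" "w \<in> borel_measurable M"
    and nonneg: "\<And>x. 0 \<le> u x" "\<And>x. 0 \<le> v x" "\<And>x. 0 \<le> w x"
    and le: "(\<integral>\<^sup>+x. u x \<partial>M) \<le> ennreal U" "(\<integral>\<^sup>+x. v x \<partial>M) \<le> ennreal V" "(\<integral>\<^sup>+x. w x \<partial>M) \<le> ennreal W"
    and UVW: "0 \<le> U" "0 \<le> V" "0 \<le> W"
    and lmn: "0 \<le> l" "0 \<le> m" "0 \<le> n" "l + m + n = 1"
  shows "(\<integral>\<^sup>+x. ennreal (u x powr l * v x powr m * w x powr n) \<partial>M)
      \<le> ennreal (U powr l * V powr m * W powr n)"
proof (cases "U = 0 \<or> V = 0 \<or> W = 0")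
  case True
  then consider "(\<integral>\<^sup>+x. u x \<partial>M) = 0" | "(\<integral>\<^sup>+x. v x \<partial>M) = 0" | "(\<integral>\<^sup>+x. w x \<partial>M) = 0"
    using le by auto
  then have "AE x in M. ennreal (u x powr l * v x powr m * w x powr n) = 0"
  proof cases
    case 1
    then have "AE x in M. u x = 0" using nonneg by (simp add: nn_integral_0_iff_AE)
    then show ?thesis by (rule eventually_mono) simp
  next
    case 2
    then have "AE x in M. v x = 0" using nonneg by (simp add: nn_integral_0_iff_AE)
    then show ?thesis by (rule eventually_mono) simp
  next
    case 3
    then have "AE x in M. w x = 0" using nonneg by (simp add: nn_integral_0_iff_AE)
    then show ?thesis by (rule eventually_mono) simp
  qed
  then have "(\<integral>\<^sup>+x. ennreal (u x powr l * v x powr m * w x powr n) \<partial>M) = 0"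
    by (subst nn_integral_0_iff_AE) auto
  then show ?thesis by simp
next
  case False
  then have pos: "U > 0" "V > 0" "W > 0" using UVW by auto
  define K where "K = U powr l * V powr m * W powr n"
  have K: "K > 0" unfolding K_def using pos by simp
  have ptw: "u x powr l * v x powr m * w x powr n
      \<le> K * (l / U) * u x + K * (m / V) * v x + K * (n / W) * w x" for x
  proof -
    have "u x powr l * v x powr m * w x powr n
        = K * ((u x / U) powr l * (v x / V) powr m * (w x / W) powr n)"
      unfolding K_def using pos by (simp add: powr_divide)
    also have "\<dots> \<le> K * (l * (u x / U) + m * (v x / V) + n * (w x / W))"
      using K pos nonneg lmn by (intro mult_left_mono weighted_AM_GM3) auto
    finally show ?thesis by (simp add: algebra_simps)
  qed
  have "(\<integral>\<^sup>+x. ennreal (u x powr l * v x powr m * w x powr n) \<partial>M)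
     \<le> (\<integral>\<^sup>+x. ennreal (K * (l / U)) * u x + ennreal (K * (m / V)) * v x + ennreal (K * (n / W)) * w x \<partial>M)"
    using ptw K pos lmn nonneg
    by (intro nn_integral_mono) (simp flip: ennreal_mult ennreal_plus)
  also have "\<dots> = ennreal (K * (l / U)) * (\<integral>\<^sup>+x. u x \<partial>M) + ennreal (K * (m / V)) * (\<integral>\<^sup>+x. v x \<partial>M)
      + ennreal (K * (n / W)) * (\<integral>\<^sup>+x. w x \<partial>M)"
    by (simp add: nn_integral_add nn_integral_cmult)
  also have "\<dots> \<le> ennreal (K * (l / U)) * ennreal U + ennreal (K * (m / V)) * ennreal V
      + ennreal (K * (n / W)) * ennreal W"
    using le by (intro add_mono mult_left_mono) auto
  also have "\<dots> = ennreal (K * l + K * m + K * n)"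
    using K pos lmn by (simp flip: ennreal_mult ennreal_plus)
  also have "K * l + K * m + K * n = K"
    using lmn(4) by (metis distrib_left mult.right_neutral)
  finally show ?thesis unfolding K_def .
qed

subsection \<open>Haar measure of the multiplicative group\<close>

text \<open>The group measure is encoded on the whole line, so that Borel measurability on
  \<open>real\<close> applies directly. The density takes the value \<open>1 / 0 = 0\<close> at the
  origin, a null point in any case.\<close>

definition mult_haar :: "real measure" where
  "mult_haar = density lborel (\<lambda>z. ennreal (1 / \<bar>z\<bar>))"

lemma sets_mult_haar [measurable_cong, simp]: "sets mult_haar = sets borel"
  by (simp add: mult_haar_def)

lemma sigma_finite_mult_haar: "sigma_finite_measure mult_haar"
  unfolding mult_haar_def
  by (subst sigma_finite_measure.sigma_finite_iff_density_finite[OF sigma_finite_lborel]) auto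

interpretation mult_haar: sigma_finite_measure mult_haar
  by (rule sigma_finite_mult_haar)

lemma AE_mult_haar_iff: "(AE z in mult_haar. P z) \<longleftrightarrow> (AE z in lborel. P z)"
proof -
  have "(AE z in mult_haar. P z) \<longleftrightarrow> (AE z in lborel. z \<noteq> 0 \<longrightarrow> P z)"
    unfolding mult_haar_def by (subst AE_density) auto
  also have "\<dots> \<longleftrightarrow> (AE z in lborel. P z)"
    using AE_lborel_singleton[of "0::real"]
    by (auto elim: eventually_elim2)
  finally show ?thesis .
qed

lemma nn_integral_mult_haar:
  assumes [measurable]: "f \<in> borel_measurable borel"
  shows "(\<integral>\<^sup>+z. f z \<partial>mult_haar) = (\<integral>\<^sup>+z. ennreal (1 / \<bar>z\<bar>) * f z \<partial>lborel)"
  by (simp add: mult_haar_def nn_integral_density)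

text \<open>The factor \<open>\<bar>c\<bar>\<close> from the affine substitution is cancelled by the
  density at \<open>c * z\<close>.\<close>

lemma nn_integral_mult_haar_scale:
  fixes c :: real
  assumes [measurable]: "f \<in> borel_measurable borel" and "c \<noteq> 0"
  shows "(\<integral>\<^sup>+z. f (c * z) \<partial>mult_haar) = (\<integral>\<^sup>+z. f z \<partial>mult_haar)"
proof -
  have "(\<integral>\<^sup>+z. f z \<partial>mult_haar)
      = ennreal \<bar>c\<bar> * (\<integral>\<^sup>+z. ennreal (1 / \<bar>0 + c * z\<bar>) * f (0 + c * z) \<partial>lborel)"
    using assms by (simp only: nn_integral_mult_haar) (rule nn_integral_real_affine, auto)
  also have "\<dots> = (\<integral>\<^sup>+z. ennreal (1 / \<bar>z\<bar>) * f (c * z) \<partial>lborel)"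
    using assms(2)
    by (subst nn_integral_cmult[symmetric])
       (auto simp: abs_mult mult.assoc[symmetric] simp flip: ennreal_mult intro!: nn_integral_cong)
  finally show ?thesis by (simp add: nn_integral_mult_haar)
qed

text \<open>As in the uniqueness proof for Haar measure, testing against \<open>h\<close>, the indicator of
  \<open>[1, 2]\<close>, derives inversion invariance from scale invariance and Tonelli alone.\<close>

lemma nn_integral_mult_haar_inverse:
  assumes [measurable]: "g \<in> borel_measurable borel"
  shows "(\<integral>\<^sup>+z. g (1 / z) \<partial>mult_haar) = (\<integral>\<^sup>+z. g z \<partial>mult_haar)" (is "?I = ?G")
proof -
  interpret pair_sigma_finite mult_haar mult_haar ..
  define h :: "real \<Rightarrow> ennreal" where "h = indicator {1..2}"
  have [measurable]: "h \<in> borel_measurable borel" unfolding h_def by simp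
  define H where "H = (\<integral>\<^sup>+x. h x \<partial>mult_haar)"
  have ae0: "AE x in mult_haar. x \<noteq> (0::real)"
    unfolding AE_mult_haar_iff by (rule AE_lborel_singleton)
  have "H * ?I = (\<integral>\<^sup>+x. h x * ?I \<partial>mult_haar)"
    unfolding H_def by (simp add: nn_integral_multc)
  \<comment> \<open>Scaling \<open>z\<close> by \<open>1 / x\<close> produces a genuine double
    integral. After exchanging the order, scaling \<open>x\<close> by \<open>z\<close> moves the
    quotient from \<open>g\<close> into a product inside \<open>h\<close>; a second exchange then
    lets the \<open>z\<close> integral collapse to \<open>H\<close>.\<close>
  also have "\<dots> = (\<integral>\<^sup>+x. (\<integral>\<^sup>+z. h x * g (x / z) \<partial>mult_haar) \<partial>mult_haar)"
  proof (rule nn_integral_cong_AE, rule eventually_mono[OF ae0])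
    fix x :: real assume "x \<noteq> 0"
    then have "?I = (\<integral>\<^sup>+z. g (1 / ((1 / x) * z)) \<partial>mult_haar)"
      by (subst nn_integral_mult_haar_scale[where c = "1 / x" and f = "\<lambda>z. g (1 / z)"]) auto
    then show "h x * ?I = (\<integral>\<^sup>+z. h x * g (x / z) \<partial>mult_haar)"
      by (simp add: nn_integral_cmult)
  qed
  also have "\<dots> = (\<integral>\<^sup>+z. (\<integral>\<^sup>+x. h x * g (x / z) \<partial>mult_haar) \<partial>mult_haar)"
    by (rule Fubini'[symmetric]) measurable
  also have "\<dots> = (\<integral>\<^sup>+z. (\<integral>\<^sup>+x. h (x * z) * g x \<partial>mult_haar) \<partial>mult_haar)"
  proof (rule nn_integral_cong_AE, rule eventually_mono[OF ae0])
    fix z :: real assume "z \<noteq> 0"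
    then show "(\<integral>\<^sup>+x. h x * g (x / z) \<partial>mult_haar) = (\<integral>\<^sup>+x. h (x * z) * g x \<partial>mult_haar)"
      by (subst nn_integral_mult_haar_scale[where c = z and f = "\<lambda>x. h x * g (x / z)", symmetric])
         (auto simp: mult.commute)
  qed
  also have "\<dots> = (\<integral>\<^sup>+x. (\<integral>\<^sup>+z. h (x * z) * g x \<partial>mult_haar) \<partial>mult_haar)"
    by (rule Fubini') measurable
  also have "\<dots> = (\<integral>\<^sup>+x. H * g x \<partial>mult_haar)"
  proof (rule nn_integral_cong_AE, rule eventually_mono[OF ae0])
    fix x :: real assume "x \<noteq> 0"
    then show "(\<integral>\<^sup>+z. h (x * z) * g x \<partial>mult_haar) = H * g x"
      unfolding H_def by (simp add: nn_integral_multc nn_integral_mult_haar_scale)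
  qed
  also have "\<dots> = H * ?G"
    by (simp add: nn_integral_cmult)
  finally have eq: "H * ?I = H * ?G" .
  \<comment> \<open>Cancelling \<open>H\<close> requires that it be neither 0 nor infinite; this
    follows since the density lies between 1/2 and 1 on [1, 2].\<close>
  have H_eq: "H = (\<integral>\<^sup>+x. ennreal (1 / \<bar>x\<bar>) * h x \<partial>lborel)"
    unfolding H_def by (simp add: nn_integral_mult_haar)
  have "H \<le> (\<integral>\<^sup>+x. indicator {1..2::real} x \<partial>lborel)"
    unfolding H_eq h_def
    by (intro nn_integral_mono) (auto split: split_indicator simp: ennreal_le_1)
  also have "\<dots> < \<infinity>" by simp
  finally have fin: "H < \<infinity>" .
  have "(\<integral>\<^sup>+x. ennreal (1 / 2) * indicator {1..2::real} x \<partial>lborel) \<le> H"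
    unfolding H_eq h_def
  proof (rule nn_integral_mono)
    fix x :: real
    have "ennreal (1 / 2) \<le> ennreal (1 / \<bar>x\<bar>)" if "x \<in> {1..2}"
      using that by (intro ennreal_leI) (auto simp: field_simps)
    then show "ennreal (1 / 2) * indicator {1..2} x \<le> ennreal (1 / \<bar>x\<bar>) * indicator {1..2} x"
      by (auto split: split_indicator)
  qed
  moreover have "(\<integral>\<^sup>+x. ennreal (1 / 2) * indicator {1..2::real} x \<partial>lborel) > 0"
    by (subst nn_integral_cmult_indicator) (auto simp: zero_less_iff_neq_zero)
  ultimately have "H > 0" by order
  with eq fin show ?thesis
    by (auto simp: ennreal_mult_cancel_left)
qed

text \<open>Inversion invariance applied to \<open>g (x * z)\<close>, followed by scale
  invariance.\<close>

lemma nn_integral_mult_haar_reflect: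
  fixes x :: real
  assumes [measurable]: "g \<in> borel_measurable borel" and "x \<noteq> 0"
  shows "(\<integral>\<^sup>+z. g (x / z) \<partial>mult_haar) = (\<integral>\<^sup>+z. g z \<partial>mult_haar)"
  using assms nn_integral_mult_haar_inverse[of "\<lambda>z. g (x * z)"]
  by (simp add: nn_integral_mult_haar_scale)

section \<open>Young's inequality on the multiplicative group\<close>

text \<open>Taking \<open>1 / p\<close>, \<open>1 / q\<close> and \<open>1 / s\<close> as the parameters and stating the estimate pointwise in terms
  of an integrable majorant \<open>U\<close> makes \<open>q = \<infinity>\<close>, that is \<open>r = 0\<close>, an ordinary case.\<close>

lemma mult_haar_Young:
  fixes k F :: "real \<Rightarrow> real" and a r t V W :: real
  assumes [measurable]: "k \<in> borel_measurable borel" "F \<in> borel_measurable borel"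
    and nonneg: "\<And>x. 0 \<le> k x" "\<And>x. 0 \<le> F x"
    and exps: "0 < a" "a \<le> 1" "0 < t" "t \<le> 1" "0 \<le> r" "r = a + t - 1"
    and V: "(\<integral>\<^sup>+z. k z powr (1 / t) \<partial>mult_haar) = ennreal V" "0 \<le> V"
    and W: "(\<integral>\<^sup>+z. F z powr (1 / a) \<partial>mult_haar) = ennreal W" "0 \<le> W"
  obtains U :: "real \<Rightarrow> real" where "U \<in> borel_measurable borel" "\<And>x. 0 \<le> U x"
    "(\<integral>\<^sup>+x. U x \<partial>mult_haar) = ennreal (V * W)"
    "AE x in lborel. (\<integral>\<^sup>+z. ennreal (k (x / z) * F z) \<partial>mult_haar)
       \<le> ennreal (U x powr r * V powr (1 - a) * W powr (1 - t))"
proof -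
  interpret pair_sigma_finite mult_haar mult_haar ..
  \<comment> \<open>\<open>I\<close> is the convolution of the powers \<open>k powr (1 / t)\<close>
    and \<open>F powr (1 / a)\<close>. By Tonelli and scale invariance its integral is
    \<open>V * W\<close>.\<close>
  define I where "I x = (\<integral>\<^sup>+z. ennreal (k (x / z) powr (1 / t) * F z powr (1 / a)) \<partial>mult_haar)" for x
  have [measurable]: "I \<in> borel_measurable borel"
    unfolding I_def by measurable
  \<comment> \<open>\<open>enn2real\<close> sends infinity to 0, which is harmless because
    \<open>I\<close> is finite almost everywhere.\<close>
  define U where "U x = enn2real (I x)" for x
  have [measurable]: "U \<in> borel_measurable borel"
    unfolding U_def by measurable
  have ae0: "AE x in mult_haar. x \<noteq> (0::real)"
    unfolding AE_mult_haar_iff by (rule AE_lborel_singleton)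
  have "(\<integral>\<^sup>+x. I x \<partial>mult_haar)
      = (\<integral>\<^sup>+z. (\<integral>\<^sup>+x. ennreal (k (x / z) powr (1 / t) * F z powr (1 / a)) \<partial>mult_haar) \<partial>mult_haar)"
    unfolding I_def by (rule Fubini'[symmetric]) measurable
  also have "\<dots> = (\<integral>\<^sup>+z. ennreal V * ennreal (F z powr (1 / a)) \<partial>mult_haar)"
  proof (rule nn_integral_cong_AE, rule eventually_mono[OF ae0])
    fix z :: real assume "z \<noteq> 0"
    then have "(\<integral>\<^sup>+x. k (x / z) powr (1 / t) \<partial>mult_haar) = ennreal V"
      unfolding V(1)[symmetric]
      using nn_integral_mult_haar_scale[of "\<lambda>x. ennreal (k x powr (1 / t))" "1 / z"] by simp
    then show "(\<integral>\<^sup>+x. ennreal (k (x / z) powr (1 / t) * F z powr (1 / a)) \<partial>mult_haar)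
        = ennreal V * ennreal (F z powr (1 / a))"
      by (simp add: ennreal_mult nn_integral_multc)
  qed
  also have "\<dots> = ennreal (V * W)"
    using V(2) W by (simp add: nn_integral_cmult ennreal_mult)
  finally have intI: "(\<integral>\<^sup>+x. I x \<partial>mult_haar) = ennreal (V * W)" .
  then have finI: "AE x in mult_haar. I x \<noteq> \<infinity>"
    by (intro nn_integral_noteq_infinite) auto
  have "(\<integral>\<^sup>+x. U x \<partial>mult_haar) = (\<integral>\<^sup>+x. I x \<partial>mult_haar)"
    using finI by (intro nn_integral_cong_AE) (auto simp: U_def less_top elim: eventually_mono)
  moreover have "AE x in mult_haar. (\<integral>\<^sup>+z. ennreal (k (x / z) * F z) \<partial>mult_haar)
       \<le> ennreal (U x powr r * V powr (1 - a) * W powr (1 - t))"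
    using finI ae0
  proof eventually_elim
    case (elim x)
    \<comment> \<open>The weights \<open>r\<close>, \<open>1 - a\<close> and \<open>1 - t\<close>
      sum to 1. Since \<open>r = a + t - 1\<close>, the total exponents
      \<open>(r + (1 - a)) / t\<close> of \<open>k\<close> and \<open>(r + (1 - t)) / a\<close> of
      \<open>F\<close> are both 1.\<close>
    have split: "k (x / z) * F z = (k (x / z) powr (1 / t) * F z powr (1 / a)) powr r
        * (k (x / z) powr (1 / t)) powr (1 - a) * (F z powr (1 / a)) powr (1 - t)" (is "_ = ?rhs") for z
    proof -
      have "?rhs = k (x / z) powr ((r + (1 - a)) / t) * F z powr ((r + (1 - t)) / a)"
        by (simp add: powr_mult powr_powr powr_add add_divide_distrib mult_ac)
      then show ?thesis using exps nonneg by simp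
    qed
    have V': "(\<integral>\<^sup>+z. k (x / z) powr (1 / t) \<partial>mult_haar) = ennreal V"
      unfolding V(1)[symmetric]
      using elim nn_integral_mult_haar_reflect[of "\<lambda>x. ennreal (k x powr (1 / t))" x] by simp
    show ?case
      unfolding split
      using elim exps V W V' unfolding I_def
      by (intro nn_integral_Holder3) (auto simp: U_def I_def less_top)
  qed
  ultimately show thesis
    using intI by (intro that[of U]) (auto simp: AE_mult_haar_iff U_def[of "_"])
qed

subsection \<open>Extended powers and Lebesgue norms\<close>

lemma ennreal_powr_mono: "0 \<le> t \<Longrightarrow> x \<le> y \<Longrightarrow> ennreal_powr x t \<le> ennreal_powr y t"
  by (cases x; cases y) (auto simp: ennreal_powr_def top_unique intro!: ennreal_leI powr_mono2)

lemma ennreal_powr_ennreal: "0 \<le> x \<Longrightarrow> ennreal_powr (ennreal x) t = ennreal (x powr t)"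
  by (simp add: ennreal_powr_def)

lemma ennreal_powr_less_top_iff: "ennreal_powr x t < \<infinity> \<longleftrightarrow> x < \<infinity>"
  by (simp add: ennreal_powr_def less_top)

text \<open>The larger function may be non-measurable: for it \<open>esssup\<close> is infinite by
  definition. This matters below, where the majorant \<open>G\<close> comes without a measurability
  statement.\<close>

lemma Lp_norm_mono_AE:
  assumes "f \<in> borel_measurable M" "0 \<le> p" "AE x in M. cmod (f x) \<le> cmod (g x)"
  shows "Lp_norm M p f \<le> Lp_norm M p g"
proof (cases "p = \<infinity>")
  case True
  then show ?thesis
    using assms by (auto simp: Lp_norm_def intro!: esssup_AE_mono elim: eventually_mono)
next
  case False
  have "(\<integral>\<^sup>+x. ennreal (cmod (f x) powr real_of_ereal p) \<partial>M)
      \<le> (\<integral>\<^sup>+x. ennreal (cmod (g x) powr real_of_ereal p) \<partial>M)"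
    using assms
    by (intro nn_integral_mono_AE)
       (auto intro!: ennreal_leI powr_mono2 real_of_ereal_pos elim: eventually_mono)
  then show ?thesis
    using False assms(2) by (simp add: Lp_norm_def ennreal_powr_mono real_of_ereal_pos)
qed

lemma Lp_norm_cong_AE:
  assumes "f \<in> borel_measurable M" "g \<in> borel_measurable M" "0 \<le> p" "AE x in M. f x = g x"
  shows "Lp_norm M p f = Lp_norm M p g"
  using assms by (intro order.antisym Lp_norm_mono_AE) (auto elim: eventually_mono)

section \<open>Borel representatives and null sets under reflection\<close>

lemma lebesgue_ex_borel_complex:
  fixes g :: "real \<Rightarrow> complex"
  assumes "g \<in> borel_measurable lebesgue"
  obtains h where "h \<in> borel_measurable borel" "AE x in lborel. g x = h x"
proof -
  have "(\<lambda>x. Re (g x)) \<in> borel_measurable (completion lborel)"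
    "(\<lambda>x. Im (g x)) \<in> borel_measurable (completion lborel)"
    using assms by auto
  from this[THEN completion_ex_borel_measurable_real]
  obtain u v where uv: "u \<in> borel_measurable lborel" "AE x in lborel. Re (g x) = u x"
      "v \<in> borel_measurable lborel" "AE x in lborel. Im (g x) = v x"
    by blast
  show thesis
  proof
    show "(\<lambda>x. Complex (u x) (v x)) \<in> borel_measurable borel"
      using uv by (simp add: complex_eq_iff borel_measurable_complex_iff)
    show "AE x in lborel. g x = Complex (u x) (v x)"
      using uv(2,4) by eventually_elim (simp add: complex_eq_iff)
  qed
qed

text \<open>The map sending \<open>z\<close> to \<open>x / z\<close> preserves
  \<open>mult_haar\<close>, hence its null sets, and these are the null sets of
  \<open>lborel\<close>.\<close>

lemma AE_lborel_reflect:
  fixes x :: real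
  assumes "AE u in lborel. P u" "x \<noteq> 0"
  shows "AE z in lborel. P (x / z)"
proof -
  obtain N where N: "{u \<in> space lborel. \<not> P u} \<subseteq> N" "N \<in> null_sets lborel"
    using assms(1) by (auto simp: eventually_ae_filter)
  then have [measurable]: "N \<in> sets borel" by auto
  have "AE u in lborel. u \<notin> N"
    using N(2) by (rule AE_not_in)
  then have "AE u in mult_haar. indicator N u = (0 :: ennreal)"
    unfolding AE_mult_haar_iff by (rule eventually_mono) simp
  then have "(\<integral>\<^sup>+z. indicator N z \<partial>mult_haar) = 0"
    by (subst nn_integral_0_iff_AE) auto
  then have "(\<integral>\<^sup>+z. indicator N (x / z) \<partial>mult_haar) = 0"
    using assms(2) by (subst nn_integral_mult_haar_reflect) auto
  then have "AE z in mult_haar. indicator N (x / z) = (0 :: ennreal)"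
    by (subst (asm) nn_integral_0_iff_AE) auto
  then show ?thesis
    unfolding AE_mult_haar_iff by (rule eventually_mono) (use N(1) in \<open>auto simp: indicator_eq_0_iff\<close>)
qed

subsection \<open>The Dunkl measure\<close>

lemma dunkl_A_pos: "-1 < \<alpha> \<Longrightarrow> 0 < dunkl_A \<alpha>"
  unfolding dunkl_A_def by (intro divide_pos_pos mult_pos_pos Gamma_real_pos) auto

lemma space_dunkl_measure [simp]: "space (dunkl_measure \<alpha>) = UNIV"
  by (simp add: dunkl_measure_def)

lemma sets_dunkl_measure [simp, measurable_cong]: "sets (dunkl_measure \<alpha>) = sets lebesgue"
  by (simp add: dunkl_measure_def)

lemma borel_measurable_dunkl: "f \<in> borel_measurable borel \<Longrightarrow> f \<in> borel_measurable (dunkl_measure \<alpha>)"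
  unfolding dunkl_measure_def by (simp add: measurable_completion)

lemma dunkl_density_measurable [measurable]:
  "(\<lambda>x::real. dunkl_A \<alpha> * \<bar>x\<bar> powr (2 * \<alpha> + 1)) \<in> borel_measurable lebesgue"
  by (rule measurable_completion) simp

lemma AE_dunkl_iff:
  assumes "-1 < \<alpha>"
  shows "(AE x in dunkl_measure \<alpha>. P x) \<longleftrightarrow> (AE x in lborel. P x)"
proof -
  have "(AE x in dunkl_measure \<alpha>. P x) \<longleftrightarrow> (AE x in lebesgue. x \<noteq> 0 \<longrightarrow> P x)"
    unfolding dunkl_measure_def
    using dunkl_A_pos[OF assms] by (subst AE_density) (auto simp: zero_less_mult_iff)
  also have "\<dots> \<longleftrightarrow> (AE x in lborel. x \<noteq> 0 \<longrightarrow> P x)"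
    by (rule AE_completion_iff)
  also have "\<dots> \<longleftrightarrow> (AE x in lborel. P x)"
    using AE_lborel_singleton[of "0::real"] by (auto elim: eventually_elim2)
  finally show ?thesis .
qed

text \<open>Writing dz as \<open>\<bar>z\<bar>\<close> times the Haar measure raises the exponent of
  the density from \<open>2 * \<alpha> + 1\<close> to the homogeneous dimension
  \<open>2 * \<alpha> + 2\<close>.\<close>

lemma nn_integral_dunkl:
  assumes [measurable]: "g \<in> borel_measurable borel" and "-1 < \<alpha>"
  shows "(\<integral>\<^sup>+z. g z \<partial>dunkl_measure \<alpha>)
      = (\<integral>\<^sup>+z. ennreal (dunkl_A \<alpha> * \<bar>z\<bar> powr (2 * \<alpha> + 2)) * g z \<partial>mult_haar)"
proof -
  have "(\<integral>\<^sup>+z. g z \<partial>dunkl_measure \<alpha>)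
      = (\<integral>\<^sup>+z. ennreal (dunkl_A \<alpha> * \<bar>z\<bar> powr (2 * \<alpha> + 1)) * g z \<partial>lborel)"
    unfolding dunkl_measure_def
    by (subst nn_integral_density) (auto simp: nn_integral_completion intro: measurable_completion)
  also have "\<dots> = (\<integral>\<^sup>+z. ennreal (dunkl_A \<alpha> * \<bar>z\<bar> powr (2 * \<alpha> + 2)) * g z \<partial>mult_haar)"
  proof (subst nn_integral_mult_haar, simp, rule nn_integral_cong)
    fix z :: real
    have "1 / \<bar>z\<bar> * (dunkl_A \<alpha> * \<bar>z\<bar> powr (2 * \<alpha> + 2)) = dunkl_A \<alpha> * \<bar>z\<bar> powr (2 * \<alpha> + 1)"
      using powr_mult_base[of "\<bar>z\<bar>" "2 * \<alpha> + 1"] by (cases "z = 0") (auto simp: field_simps)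
    then show "ennreal (dunkl_A \<alpha> * \<bar>z\<bar> powr (2 * \<alpha> + 1)) * g z
        = ennreal (1 / \<bar>z\<bar>) * (ennreal (dunkl_A \<alpha> * \<bar>z\<bar> powr (2 * \<alpha> + 2)) * g z)"
      using dunkl_A_pos[OF assms(2)] by (simp add: mult.assoc[symmetric] flip: ennreal_mult)
  qed
  finally show ?thesis .
qed

section \<open>The operator on Borel functions\<close>

context
  fixes \<psi> f :: "real \<Rightarrow> complex"
  assumes [measurable]: "\<psi> \<in> borel_measurable borel" "f \<in> borel_measurable borel"
begin

lemma hausdorff_integrand_measurable [measurable]:
  "(\<lambda>(x, z). hausdorff_integrand \<psi> \<beta> f x z) \<in> borel_measurable (borel \<Otimes>\<^sub>M borel)"
  unfolding hausdorff_integrand_def by measurable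

lemma hausdorff_integrand_measurable1 [measurable]:
  "hausdorff_integrand \<psi> \<beta> f x \<in> borel_measurable borel"
  unfolding hausdorff_integrand_def by measurable

text \<open>The density is moved into the integrand, because measurability of a parameter integral
  is available for the sigma-finite Borel measure \<open>lborel\<close> and a jointly Borel
  integrand.\<close>

lemma dunkl_hausdorff_measurable:
  assumes "-1 < \<alpha>"
  shows "dunkl_hausdorff \<alpha> \<psi> \<beta> f \<in> borel_measurable borel"
proof -
  have "(\<integral>z. hausdorff_integrand \<psi> \<beta> f x z \<partial>dunkl_measure \<alpha>)
      = (\<integral>z. (dunkl_A \<alpha> * \<bar>z\<bar> powr (2 * \<alpha> + 1)) *\<^sub>R hausdorff_integrand \<psi> \<beta> f x z \<partial>lborel)" for x
    unfolding dunkl_measure_def using dunkl_A_pos[OF assms]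
    by (subst integral_density) (auto intro!: measurable_completion integral_completion)
  then show ?thesis
    unfolding dunkl_hausdorff_def by (simp del: scaleR_scaleR)
qed

lemma integrable_hausdorff_integrand:
  assumes "(\<integral>\<^sup>+z. ennreal (cmod (hausdorff_integrand \<psi> \<beta> f x z)) \<partial>dunkl_measure \<alpha>) < \<infinity>"
  shows "integrable (dunkl_measure \<alpha>) (hausdorff_integrand \<psi> \<beta> f x)"
  using assms by (auto simp: integrable_iff_bounded intro!: borel_measurable_dunkl)

text \<open>The factor \<open>\<bar>x\<bar> powr (2 * \<alpha> + 1)\<close> in the hypothesis
  cancels the prefactor of the operator.\<close>

lemma cmod_dunkl_hausdorff_le:
  assumes "(\<integral>\<^sup>+z. ennreal (cmod (hausdorff_integrand \<psi> \<beta> f x z)) \<partial>dunkl_measure \<alpha>)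
      \<le> ennreal (\<bar>x\<bar> powr (2 * \<alpha> + 1) * G)" "x \<noteq> 0" "0 \<le> G"
  shows "cmod (dunkl_hausdorff \<alpha> \<psi> \<beta> f x) \<le> G"
proof -
  have "integrable (dunkl_measure \<alpha>) (hausdorff_integrand \<psi> \<beta> f x)"
    using assms(1) by (intro integrable_hausdorff_integrand) (auto simp: le_less_trans)
  then have "ennreal (cmod (\<integral>z. hausdorff_integrand \<psi> \<beta> f x z \<partial>dunkl_measure \<alpha>))
      \<le> ennreal (\<bar>x\<bar> powr (2 * \<alpha> + 1) * G)"
    using assms(1) by (intro order_trans[OF integral_norm_bound_ennreal])
  then have "cmod (\<integral>z. hausdorff_integrand \<psi> \<beta> f x z \<partial>dunkl_measure \<alpha>) \<le> \<bar>x\<bar> powr (2 * \<alpha> + 1) * G"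
    using assms(3) by (simp add: ennreal_le_iff)
  then show ?thesis
    using assms(2) by (simp add: dunkl_hausdorff_def norm_mult norm_divide field_simps)
qed

text \<open>This is the passage to a multiplicative convolution, with \<open>a\<close> and
  \<open>r\<close> in the roles of 1/p and 1/q. The powers of \<open>\<bar>z\<bar>\<close> balance
  because \<open>d - (1 - \<beta>) = d * a - (d * r - (2 * \<alpha> + 1))\<close>.\<close>

lemma nn_integral_hausdorff_integrand:
  assumes "-1 < \<alpha>" "d = 2 * \<alpha> + 2" "d * r = d * a - \<beta>" "x \<noteq> 0"
  shows "(\<integral>\<^sup>+z. ennreal (cmod (hausdorff_integrand \<psi> \<beta> f x z)) \<partial>dunkl_measure \<alpha>)
    = ennreal (dunkl_A \<alpha> * \<bar>x\<bar> powr (2 * \<alpha> + 1 - d * r)) *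
      (\<integral>\<^sup>+z. ennreal ((cmod (\<psi> (x / z)) * \<bar>x / z\<bar> powr (d * r - (2 * \<alpha> + 1))) *
                  (cmod (f z) * \<bar>z\<bar> powr (d * a))) \<partial>mult_haar)"
proof -
  have A: "dunkl_A \<alpha> > 0" using assms(1) by (rule dunkl_A_pos)
  have eq: "dunkl_A \<alpha> * \<bar>z\<bar> powr (2 * \<alpha> + 2) * cmod (hausdorff_integrand \<psi> \<beta> f x z)
      = dunkl_A \<alpha> * \<bar>x\<bar> powr (2 * \<alpha> + 1 - d * r) *
        ((cmod (\<psi> (x / z)) * \<bar>x / z\<bar> powr (d * r - (2 * \<alpha> + 1))) * (cmod (f z) * \<bar>z\<bar> powr (d * a)))" for z
  proof (cases "z = 0")
    case False
    have "\<bar>z\<bar> powr (2 * \<alpha> + 2) / \<bar>z\<bar> powr (1 - \<beta>) = \<bar>z\<bar> powr (d * a) / \<bar>z\<bar> powr (d * r - (2 * \<alpha> + 1))"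
      using assms(3) by (simp flip: powr_diff) (simp add: algebra_simps)
    moreover have "\<bar>x\<bar> powr (2 * \<alpha> + 1 - d * r) * \<bar>x\<bar> powr (d * r - (2 * \<alpha> + 1)) = 1"
      using assms(4) by (simp flip: powr_add)
    moreover have "dunkl_A \<alpha> * \<bar>z\<bar> powr (2 * \<alpha> + 2) * cmod (hausdorff_integrand \<psi> \<beta> f x z)
        = dunkl_A \<alpha> * cmod (\<psi> (x / z)) * cmod (f z) * (\<bar>z\<bar> powr (2 * \<alpha> + 2) / \<bar>z\<bar> powr (1 - \<beta>))"
      by (simp add: hausdorff_integrand_def norm_mult norm_divide)
    moreover have "dunkl_A \<alpha> * \<bar>x\<bar> powr (2 * \<alpha> + 1 - d * r) *
          ((cmod (\<psi> (x / z)) * \<bar>x / z\<bar> powr (d * r - (2 * \<alpha> + 1))) * (cmod (f z) * \<bar>z\<bar> powr (d * a)))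
        = dunkl_A \<alpha> * cmod (\<psi> (x / z)) * cmod (f z) *
          (\<bar>x\<bar> powr (2 * \<alpha> + 1 - d * r) * \<bar>x\<bar> powr (d * r - (2 * \<alpha> + 1))) *
          (\<bar>z\<bar> powr (d * a) / \<bar>z\<bar> powr (d * r - (2 * \<alpha> + 1)))"
      by (simp add: powr_divide)
    ultimately show ?thesis by simp
  qed simp
  have "(\<integral>\<^sup>+z. ennreal (cmod (hausdorff_integrand \<psi> \<beta> f x z)) \<partial>dunkl_measure \<alpha>)
      = (\<integral>\<^sup>+z. ennreal (dunkl_A \<alpha> * \<bar>z\<bar> powr (2 * \<alpha> + 2) * cmod (hausdorff_integrand \<psi> \<beta> f x z)) \<partial>mult_haar)"
    using A assms(1) by (simp add: nn_integral_dunkl ennreal_mult)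
  also have "\<dots> = ennreal (dunkl_A \<alpha> * \<bar>x\<bar> powr (2 * \<alpha> + 1 - d * r)) *
      (\<integral>\<^sup>+z. ennreal ((cmod (\<psi> (x / z)) * \<bar>x / z\<bar> powr (d * r - (2 * \<alpha> + 1))) *
                  (cmod (f z) * \<bar>z\<bar> powr (d * a))) \<partial>mult_haar)"
    unfolding eq using A by (subst ennreal_mult) (auto simp: nn_integral_cmult)
  finally show ?thesis .
qed

end

subsection \<open>Boundedness for Borel functions\<close>

text \<open>Here \<open>a\<close>, \<open>r\<close> and \<open>t\<close> stand for 1/p, 1/q and 1/s,
  with the value 0 encoding an infinite exponent, so that the relation between the exponents is one
  between real numbers.\<close>

context
  fixes \<alpha> \<beta> d a r t :: real and p q :: ereal
  assumes alpha: "-1 < \<alpha>" and d: "d = 2 * \<alpha> + 2" and beta: "0 \<le> \<beta>" "\<beta> < d"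
    and t: "t = 1 - \<beta> / d" and r: "r = a - \<beta> / d"
    and p: "p = \<infinity> \<and> a = 0 \<or> 0 < a \<and> a \<le> 1 \<and> p = ereal (1 / a)"
    and q: "q = \<infinity> \<and> r = 0 \<or> 0 < r \<and> r \<le> 1 \<and> q = ereal (1 / r)"
begin

text \<open>For finite \<open>q\<close> the weight \<open>\<bar>x\<bar> powr (- (d * r))\<close> is
  the one whose \<open>q\<close>-th power cancels the density of the Dunkl measure against Haar
  measure, leaving a constant times the integral of \<open>U\<close>.\<close>

lemma Lp_norm_majorant:
  fixes U :: "real \<Rightarrow> real"
  assumes [measurable]: "U \<in> borel_measurable borel" and U: "\<And>x. 0 \<le> U x"
    "(\<integral>\<^sup>+x. U x \<partial>mult_haar) = ennreal S" "0 \<le> S" and K: "0 \<le> K"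
  shows "Lp_norm (dunkl_measure \<alpha>) q (\<lambda>x. complex_of_real (K * \<bar>x\<bar> powr (- (d * r)) * U x powr r))
    \<le> ennreal (K * (dunkl_A \<alpha> * S) powr r)"
proof -
  have A: "0 < dunkl_A \<alpha>" using alpha by (rule dunkl_A_pos)
  let ?g = "\<lambda>x. complex_of_real (K * \<bar>x\<bar> powr (- (d * r)) * U x powr r)"
  have g_eq: "cmod (?g x) = K * \<bar>x\<bar> powr (- (d * r)) * U x powr r" for x
    using K by (simp only: norm_of_real) simp
  from q consider "q = \<infinity>" "r = 0" | "0 < r" "r \<le> 1" "q = ereal (1 / r)" by blast
  then show ?thesis
  proof cases
    case 1
    have "AE x in lborel. cmod (?g x) \<le> K * (dunkl_A \<alpha> * S) powr r"
    \<comment> \<open>With \<open>r = 0\<close> the right side is \<open>K\<close> if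
      \<open>S > 0\<close>, but 0 if \<open>S = 0\<close>, since \<open>0 powr 0 = 0\<close>. In the
      latter case \<open>U\<close> vanishes almost everywhere, and so does the left side.\<close>
    proof (cases "S = 0")
      case True
      then have "AE x in mult_haar. ennreal (U x) = 0"
        using U by (subst nn_integral_0_iff_AE[symmetric]) auto
      then show ?thesis
        unfolding AE_mult_haar_iff
        by (rule eventually_mono) (use U(1) in \<open>simp add: ennreal_eq_0_iff order_antisym True\<close>)
    next
      case False
      have "cmod (?g x) \<le> K * (dunkl_A \<alpha> * S) powr r" for x
        unfolding g_eq using False A K 1 by simp
      then show ?thesis by simp
    qed
    then have "esssup (dunkl_measure \<alpha>) (\<lambda>x. ennreal (cmod (?g x))) \<le> ennreal (K * (dunkl_A \<alpha> * S) powr r)"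
      by (intro esssup_I borel_measurable_dunkl)
         (measurable, auto simp only: AE_dunkl_iff[OF alpha] intro!: ennreal_leI elim!: eventually_mono)
    then show ?thesis
      by (simp only: Lp_norm_def 1 if_True refl)
  next
    case 2
    have powr_eq: "dunkl_A \<alpha> * \<bar>x\<bar> powr (2 * \<alpha> + 2) * cmod (?g x) powr (1 / r)
        = dunkl_A \<alpha> * K powr (1 / r) * U x" if "x \<noteq> 0" for x
    proof -
      have "\<bar>x\<bar> powr (2 * \<alpha> + 2) * \<bar>x\<bar> powr (- d) = 1"
        using that by (simp add: d flip: powr_add)
      then show ?thesis
        unfolding g_eq using 2 U(1) by (simp add: powr_mult powr_powr mult_ac)
    qed
    have "(\<integral>\<^sup>+x. ennreal (cmod (?g x) powr (1 / r)) \<partial>dunkl_measure \<alpha>)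
        = (\<integral>\<^sup>+x. ennreal (dunkl_A \<alpha> * \<bar>x\<bar> powr (2 * \<alpha> + 2) * cmod (?g x) powr (1 / r)) \<partial>mult_haar)"
      using alpha A by (subst nn_integral_dunkl) (auto simp: ennreal_mult)
    also have "\<dots> = (\<integral>\<^sup>+x. ennreal (dunkl_A \<alpha> * K powr (1 / r)) * ennreal (U x) \<partial>mult_haar)"
    proof (rule nn_integral_cong_AE)
      have "AE x in mult_haar. x \<noteq> (0::real)"
        unfolding AE_mult_haar_iff by (rule AE_lborel_singleton)
      then show "AE x in mult_haar. ennreal (dunkl_A \<alpha> * \<bar>x\<bar> powr (2 * \<alpha> + 2) * cmod (?g x) powr (1 / r))
          = ennreal (dunkl_A \<alpha> * K powr (1 / r)) * ennreal (U x)"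
        by (rule eventually_mono) (subst powr_eq, assumption, rule ennreal_mult, use A U(1) in auto)
    qed
    also have "\<dots> = ennreal (K powr (1 / r) * (dunkl_A \<alpha> * S))"
      using A K U(3) by (subst nn_integral_cmult) (auto simp: U(2) mult_ac simp flip: ennreal_mult)
    finally show ?thesis
      using 2 A K U(3) by (simp add: Lp_norm_def ennreal_powr_ennreal powr_mult powr_powr)
  qed
qed

text \<open>Bounding the integral of the absolute value, rather than the operator itself, yields
  convergence of the defining integral and the norm estimate from the same \<open>G\<close>.\<close>

lemma dunkl_hausdorff_majorant:
  fixes \<psi> f :: "real \<Rightarrow> complex"
  assumes [measurable]: "\<psi> \<in> borel_measurable borel" "f \<in> borel_measurable borel"
    and V: "(\<integral>\<^sup>+u. (cmod (\<psi> u) * \<bar>u\<bar> powr (d * r - (2 * \<alpha> + 1))) powr (1 / t) \<partial>mult_haar) = ennreal V" "0 \<le> V"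
    and f: "Lp_norm (dunkl_measure \<alpha>) p f < \<infinity>"
  obtains G :: "real \<Rightarrow> real" where "\<And>x. 0 \<le> G x"
    "AE x in lborel. (\<integral>\<^sup>+z. ennreal (cmod (hausdorff_integrand \<psi> \<beta> f x z)) \<partial>dunkl_measure \<alpha>)
       \<le> ennreal (\<bar>x\<bar> powr (2 * \<alpha> + 1) * G x)"
    "Lp_norm (dunkl_measure \<alpha>) q (\<lambda>x. complex_of_real (G x))
       \<le> ennreal ((dunkl_A \<alpha> * V) powr t) * Lp_norm (dunkl_measure \<alpha>) p f"
proof -
  have A: "0 < dunkl_A \<alpha>" using alpha by (rule dunkl_A_pos)
  have dpos: "0 < d" using d alpha by simp
  have t01: "0 < t" "t \<le> 1" using beta dpos t by auto
  have r0: "0 \<le> r" using q by auto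
  have rat: "r = a + t - 1" using r t by simp
  have dr: "d * r = d * a - \<beta>" using r dpos by (simp add: field_simps)
  define k where "k u = cmod (\<psi> u) * \<bar>u\<bar> powr (d * r - (2 * \<alpha> + 1))" for u
  define F where "F z = cmod (f z) * \<bar>z\<bar> powr (d * a)" for z
  have [measurable]: "k \<in> borel_measurable borel" "F \<in> borel_measurable borel"
    unfolding k_def F_def by measurable
  have kF0: "0 \<le> k u" "0 \<le> F u" for u by (simp_all add: k_def F_def)
  have intgrd: "(\<integral>\<^sup>+z. ennreal (cmod (hausdorff_integrand \<psi> \<beta> f x z)) \<partial>dunkl_measure \<alpha>)
      = ennreal (dunkl_A \<alpha> * \<bar>x\<bar> powr (2 * \<alpha> + 1 - d * r)) * (\<integral>\<^sup>+z. ennreal (k (x / z) * F z) \<partial>mult_haar)"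
    if "x \<noteq> 0" for x
    unfolding k_def F_def by (rule nn_integral_hausdorff_integrand) (use alpha d dr that in auto)
  have Vk: "(\<integral>\<^sup>+u. k u powr (1 / t) \<partial>mult_haar) = ennreal V"
    using V by (simp add: k_def)
  from p consider "p = \<infinity>" "a = 0" | "0 < a" "a \<le> 1" "p = ereal (1 / a)" by blast
  then show thesis
  proof cases
    case 1
    \<comment> \<open>Young's inequality above requires \<open>a > 0\<close>. For
      \<open>p = \<infinity>\<close> the relation between the exponents forces
      \<open>q = \<infinity>\<close> and \<open>t = 1\<close>, so it suffices to pair an integrable
      \<open>k\<close> with an essentially bounded \<open>F\<close>.\<close>
    then have r: "r = 0" "t = 1" using r0 rat t01 by auto
    then have qinf: "q = \<infinity>" using q by auto
    define N where "N = enn2real (Lp_norm (dunkl_measure \<alpha>) p f)"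
    have N: "Lp_norm (dunkl_measure \<alpha>) p f = ennreal N"
      using f by (simp add: N_def less_top)
    have N0: "0 \<le> N" by (simp add: N_def)
    have "AE z in dunkl_measure \<alpha>. ennreal (cmod (f z)) \<le> ennreal N"
      unfolding N[symmetric] Lp_norm_def using 1 by (simp add: esssup_AE)
    then have fN: "AE z in mult_haar. cmod (f z) \<le> N"
      using N0 by (simp add: AE_dunkl_iff[OF alpha] AE_mult_haar_iff)
    show thesis
    proof (rule that[of "\<lambda>_. dunkl_A \<alpha> * V * N"])
      show "AE x in lborel. (\<integral>\<^sup>+z. ennreal (cmod (hausdorff_integrand \<psi> \<beta> f x z)) \<partial>dunkl_measure \<alpha>)
         \<le> ennreal (\<bar>x\<bar> powr (2 * \<alpha> + 1) * (dunkl_A \<alpha> * V * N))"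
      proof (rule eventually_mono[OF AE_lborel_singleton[of 0]])
        fix x :: real assume x: "x \<noteq> 0"
        have "(\<integral>\<^sup>+z. ennreal (k (x / z) * F z) \<partial>mult_haar)
            \<le> (\<integral>\<^sup>+z. ennreal (k (x / z)) * ennreal N \<partial>mult_haar)"
        proof (rule nn_integral_mono_AE, rule eventually_mono[OF fN])
          fix z assume "cmod (f z) \<le> N"
          \<comment> \<open>As \<open>a = 0\<close>, the weight in \<open>F\<close> is 1 away from
            the origin and \<open>0 powr 0 = 0\<close> at it.\<close>
          then have "F z \<le> N" using 1 N0 by (cases "z = 0") (auto simp: F_def)
          then show "ennreal (k (x / z) * F z) \<le> ennreal (k (x / z)) * ennreal N"
            using N0 kF0 by (simp add: ennreal_leI mult_left_mono flip: ennreal_mult)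
        qed
        also have "\<dots> = ennreal V * ennreal N"
          using Vk r kF0 x nn_integral_mult_haar_reflect[of "\<lambda>x. ennreal (k x)" x]
          by (simp add: nn_integral_multc)
        finally have "(\<integral>\<^sup>+z. ennreal (cmod (hausdorff_integrand \<psi> \<beta> f x z)) \<partial>dunkl_measure \<alpha>)
            \<le> ennreal (dunkl_A \<alpha> * \<bar>x\<bar> powr (2 * \<alpha> + 1 - d * r)) * (ennreal V * ennreal N)"
          unfolding intgrd[OF x] by (rule mult_left_mono) simp
        also have "\<dots> = ennreal (\<bar>x\<bar> powr (2 * \<alpha> + 1) * (dunkl_A \<alpha> * V * N))"
          using A V N0 r by (simp add: mult_ac flip: ennreal_mult)
        finally show "(\<integral>\<^sup>+z. ennreal (cmod (hausdorff_integrand \<psi> \<beta> f x z)) \<partial>dunkl_measure \<alpha>)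
            \<le> ennreal (\<bar>x\<bar> powr (2 * \<alpha> + 1) * (dunkl_A \<alpha> * V * N))" .
      qed
      have "Lp_norm (dunkl_measure \<alpha>) q (\<lambda>x. complex_of_real (dunkl_A \<alpha> * V * N))
          \<le> ennreal (dunkl_A \<alpha> * V * N)"
        unfolding Lp_norm_def using qinf A V N0
        by (auto intro!: esssup_I simp: norm_mult)
      then show "Lp_norm (dunkl_measure \<alpha>) q (\<lambda>x. complex_of_real (dunkl_A \<alpha> * V * N))
          \<le> ennreal ((dunkl_A \<alpha> * V) powr t) * Lp_norm (dunkl_measure \<alpha>) p f"
        using r A V N0 by (simp add: N ennreal_mult)
    qed (use A V N0 in simp)
  next
    case 2
    define J where "J = (\<integral>\<^sup>+z. F z powr (1 / a) \<partial>mult_haar)"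
    \<comment> \<open>The weight in \<open>F\<close> has exponent \<open>d * a\<close>, so its power
      \<open>1 / a\<close> is exactly the density of the Dunkl measure against Haar measure, up to
      \<open>dunkl_A \<alpha>\<close>.\<close>
    have "(\<integral>\<^sup>+z. ennreal (cmod (f z) powr (1 / a)) \<partial>dunkl_measure \<alpha>)
        = (\<integral>\<^sup>+z. ennreal (dunkl_A \<alpha>) * ennreal (F z powr (1 / a)) \<partial>mult_haar)"
      using alpha A 2 d
      by (subst nn_integral_dunkl) (auto simp: F_def powr_mult powr_powr ennreal_mult mult_ac)
    also have "\<dots> = ennreal (dunkl_A \<alpha>) * J"
      unfolding J_def by (simp add: nn_integral_cmult)
    finally have norm_f: "Lp_norm (dunkl_measure \<alpha>) p f = ennreal_powr (ennreal (dunkl_A \<alpha>) * J) a"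
      using 2 by (simp add: Lp_norm_def)
    then have "ennreal (dunkl_A \<alpha>) * J < \<infinity>"
      using f by (simp add: ennreal_powr_less_top_iff[simplified])
    then have "J < \<infinity>" using A by (auto simp: ennreal_mult_less_top)
    then obtain W where W: "0 \<le> W" "J = ennreal W"
      by (cases J) auto
    have norm_f: "Lp_norm (dunkl_measure \<alpha>) p f = ennreal ((dunkl_A \<alpha> * W) powr a)"
      unfolding norm_f W(2) using A W(1) by (simp add: ennreal_powr_ennreal flip: ennreal_mult)
    obtain U :: "real \<Rightarrow> real" where [measurable]: "U \<in> borel_measurable borel"
      and U: "\<And>x. 0 \<le> U x" "(\<integral>\<^sup>+x. U x \<partial>mult_haar) = ennreal (V * W)"
      "AE x in lborel. (\<integral>\<^sup>+z. ennreal (k (x / z) * F z) \<partial>mult_haar)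
         \<le> ennreal (U x powr r * V powr (1 - a) * W powr (1 - t))"
      by (rule mult_haar_Young[of k F a t r V W])
         (use 2 t01 r0 rat kF0 Vk V(2) W J_def in auto)
    define K where "K = dunkl_A \<alpha> * V powr (1 - a) * W powr (1 - t)"
    have K: "0 \<le> K" unfolding K_def using A by simp
    show thesis
    proof (rule that[of "\<lambda>x. K * \<bar>x\<bar> powr (- (d * r)) * U x powr r"])
      show "AE x in lborel. (\<integral>\<^sup>+z. ennreal (cmod (hausdorff_integrand \<psi> \<beta> f x z)) \<partial>dunkl_measure \<alpha>)
         \<le> ennreal (\<bar>x\<bar> powr (2 * \<alpha> + 1) * (K * \<bar>x\<bar> powr (- (d * r)) * U x powr r))"
        using U(3) AE_lborel_singleton[of 0]
      proof eventually_elim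
        case (elim x)
        have "(\<integral>\<^sup>+z. ennreal (cmod (hausdorff_integrand \<psi> \<beta> f x z)) \<partial>dunkl_measure \<alpha>)
          \<le> ennreal (dunkl_A \<alpha> * \<bar>x\<bar> powr (2 * \<alpha> + 1 + - (d * r))) *
            ennreal (U x powr r * V powr (1 - a) * W powr (1 - t))"
          using intgrd[OF elim(2)] elim(1) by (simp add: mult_left_mono)
        also have "\<dots> = ennreal (\<bar>x\<bar> powr (2 * \<alpha> + 1) * (K * \<bar>x\<bar> powr (- (d * r)) * U x powr r))"
          unfolding K_def powr_add using A by (simp add: mult_ac flip: ennreal_mult)
        finally show ?case .
      qed
      have "Lp_norm (dunkl_measure \<alpha>) q (\<lambda>x. complex_of_real (K * \<bar>x\<bar> powr (- (d * r)) * U x powr r))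
          \<le> ennreal (K * (dunkl_A \<alpha> * (V * W)) powr r)"
        using U V(2) W(1) K by (intro Lp_norm_majorant) auto
      \<comment> \<open>One factor \<open>dunkl_A \<alpha>\<close> comes from the integral and a
        power \<open>r\<close> from the norm on the target side. As \<open>1 + r = t + a\<close>,
        they split into the operator constant and the norm of \<open>f\<close>.\<close>
      also have "K * (dunkl_A \<alpha> * (V * W)) powr r
          = dunkl_A \<alpha> powr (1 + r) * V powr (1 - a + r) * W powr (1 - t + r)"
        using A unfolding K_def powr_add by (simp add: powr_mult)
      also have "\<dots> = dunkl_A \<alpha> powr (t + a) * V powr t * W powr a"
        using rat by (simp add: add.commute)
      also have "\<dots> = (dunkl_A \<alpha> * V) powr t * (dunkl_A \<alpha> * W) powr a"
        by (simp add: powr_mult powr_add)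
      finally show "Lp_norm (dunkl_measure \<alpha>) q (\<lambda>x. complex_of_real (K * \<bar>x\<bar> powr (- (d * r)) * U x powr r))
          \<le> ennreal ((dunkl_A \<alpha> * V) powr t) * Lp_norm (dunkl_measure \<alpha>) p f"
        by (simp add: norm_f ennreal_mult)
    qed (use K in simp)
  qed
qed

end

subsection \<open>Reduction to Borel functions\<close>

text \<open>Completeness of Lebesgue measure: preimages under the two functions differ by a null
  set.\<close>

lemma borel_measurable_lebesgue_AE:
  fixes g h :: "real \<Rightarrow> 'b :: topological_space"
  assumes "h \<in> borel_measurable lebesgue" "AE x in lborel. g x = h x"
  shows "g \<in> borel_measurable lebesgue"
proof (rule measurableI)
  fix B :: "'b set" assume "B \<in> sets borel"
  then have h: "h -` B \<inter> space lebesgue \<in> sets lebesgue"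
    by (rule measurable_sets[OF assms(1)])
  have "AE x in lebesgue. x \<in> h -` B \<inter> space lebesgue \<longleftrightarrow> x \<in> g -` B \<inter> space lebesgue"
    using AE_completion[OF assms(2)] by (rule eventually_mono) auto
  then show "g -` B \<inter> space lebesgue \<in> sets lebesgue"
    by (rule completion.in_sets_AE) (use h in auto)
qed simp

text \<open>The summand -1 in the exponent of the weight is the Haar density, so the constant is the
  L^s norm of the convolution kernel.\<close>

lemma hausdorff_const_eq:
  assumes [measurable]: "\<psi>' \<in> borel_measurable borel" and ae: "AE z in lborel. \<psi> z = \<psi>' z"
  shows "hausdorff_const \<alpha> \<psi> s q = ennreal_powr
    (\<integral>\<^sup>+u. (cmod (\<psi>' u) * \<bar>u\<bar> powr (real_of_ereal (ereal (2 * \<alpha> + 2) / q) - (2 * \<alpha> + 1))) powr s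
       \<partial>mult_haar) (1 / s)"
proof -
  define e where "e = real_of_ereal (ereal (2 * \<alpha> + 2) / q) - (2 * \<alpha> + 1)"
  have "(\<integral>\<^sup>+z. ennreal (cmod (\<psi> z) powr s * \<bar>z\<bar> powr (s * e - 1)) \<partial>lebesgue)
      = (\<integral>\<^sup>+z. ennreal (cmod (\<psi> z) powr s * \<bar>z\<bar> powr (s * e - 1)) \<partial>lborel)"
    \<comment> \<open>The integrand need not be Borel; the nonnegative integrals over a measure and
      over its completion agree for arbitrary functions.\<close>
    by (rule nn_integral_completion)
  also have "\<dots> = (\<integral>\<^sup>+z. ennreal (1 / \<bar>z\<bar>) * ennreal ((cmod (\<psi>' z) * \<bar>z\<bar> powr e) powr s) \<partial>lborel)"
  proof (rule nn_integral_cong_AE, use ae in eventually_elim)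
    case (elim z)
    have "\<bar>z\<bar> powr (s * e - 1) = 1 / \<bar>z\<bar> * \<bar>z\<bar> powr (s * e)"
      by (cases "z = 0") (auto simp: powr_diff)
    then show ?case
      unfolding elim by (simp add: powr_mult powr_powr mult_ac flip: ennreal_mult)
  qed
  also have "\<dots> = (\<integral>\<^sup>+z. ennreal ((cmod (\<psi>' z) * \<bar>z\<bar> powr e) powr s) \<partial>mult_haar)"
    by (simp add: nn_integral_mult_haar)
  finally show ?thesis
    by (simp add: hausdorff_const_def e_def)
qed

text \<open>Reflection pulls the exceptional set of \<open>\<psi>\<close> back to a null set for
  every nonzero \<open>x\<close>, not merely for almost every one.\<close>

lemma hausdorff_integrand_cong_AE:
  assumes "AE u in lborel. \<psi> u = \<psi>' u" "AE z in lborel. f z = g z" "x \<noteq> 0"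
  shows "AE z in lborel. hausdorff_integrand \<psi> \<beta> f x z = hausdorff_integrand \<psi>' \<beta> g x z"
  using AE_lborel_reflect[OF assms(1,3)] assms(2)
  by eventually_elim (simp add: hausdorff_integrand_def)

lemma ereal_reciprocal_cases:
  fixes p :: ereal
  assumes "1 \<le> p"
  shows "p = \<infinity> \<and> real_of_ereal (1 / p) = 0 \<or>
    0 < real_of_ereal (1 / p) \<and> real_of_ereal (1 / p) \<le> 1 \<and> p = ereal (1 / real_of_ereal (1 / p))"
  using assms by (cases p) (auto simp: one_ereal_def)

theorem theorem4p1:
  fixes \<alpha> \<beta> d s :: real and p q :: ereal and \<psi> :: "real \<Rightarrow> complex"
  assumes "\<alpha> \<ge> - 1 / 2"
    and "d = 2 * \<alpha> + 2"
    and "1 \<le> p" and "1 \<le> q"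
    and "0 \<le> \<beta>" and "\<beta> < d"
    and "1 / q = 1 / p - ereal (\<beta> / d)"
    and "s = d / (d - \<beta>)"
    and "\<psi> \<in> borel_measurable lebesgue"
    and "hausdorff_const \<alpha> \<psi> s q < \<infinity>"
  shows "(\<forall>f \<in> Lp_space (dunkl_measure \<alpha>) p.
            AE x in dunkl_measure \<alpha>.
              integrable (dunkl_measure \<alpha>) (hausdorff_integrand \<psi> \<beta> f x)) \<and>
         bounded_Lp_Lq (dunkl_measure \<alpha>) p (dunkl_measure \<alpha>) q (dunkl_hausdorff \<alpha> \<psi> \<beta>)"
proof -
  define a where "a = real_of_ereal (1 / p)"
  define r where "r = real_of_ereal (1 / q)"
  define t where "t = 1 - \<beta> / d"
  have alpha: "-1 < \<alpha>" using assms(1) by simp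
  have dpos: "0 < d" using assms by simp
  have p: "p = \<infinity> \<and> a = 0 \<or> 0 < a \<and> a \<le> 1 \<and> p = ereal (1 / a)"
    unfolding a_def by (rule ereal_reciprocal_cases) fact
  have q: "q = \<infinity> \<and> r = 0 \<or> 0 < r \<and> r \<le> 1 \<and> q = ereal (1 / r)"
    unfolding r_def by (rule ereal_reciprocal_cases) fact
  have r: "r = a - \<beta> / d"
    unfolding r_def assms(7) a_def using p by (auto simp: one_ereal_def)
  have s: "s = 1 / t" using dpos assms(8) by (simp add: t_def field_simps)
  have dq: "real_of_ereal (ereal (2 * \<alpha> + 2) / q) = d * r"
    using q assms(2) by auto
  note exps = alpha assms(2,5,6) t_def r p q
  obtain \<psi>' where psi' [measurable]: "\<psi>' \<in> borel_measurable borel" and psi_ae: "AE z in lborel. \<psi> z = \<psi>' z"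
    using lebesgue_ex_borel_complex[OF assms(9)] .
  have "(\<integral>\<^sup>+u. (cmod (\<psi>' u) * \<bar>u\<bar> powr (d * r - (2 * \<alpha> + 1))) powr (1 / t) \<partial>mult_haar) < \<infinity>"
    using assms(10) unfolding hausdorff_const_eq[OF psi' psi_ae] dq s ennreal_powr_less_top_iff .
  then obtain V where V: "0 \<le> V"
    "(\<integral>\<^sup>+u. (cmod (\<psi>' u) * \<bar>u\<bar> powr (d * r - (2 * \<alpha> + 1))) powr (1 / t) \<partial>mult_haar) = ennreal V"
    by (cases "\<integral>\<^sup>+u. (cmod (\<psi>' u) * \<bar>u\<bar> powr (d * r - (2 * \<alpha> + 1))) powr (1 / t) \<partial>mult_haar") auto
  have main: "(AE x in dunkl_measure \<alpha>. integrable (dunkl_measure \<alpha>) (hausdorff_integrand \<psi> \<beta> f x)) \<and>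
      dunkl_hausdorff \<alpha> \<psi> \<beta> f \<in> borel_measurable (dunkl_measure \<alpha>) \<and>
      Lp_norm (dunkl_measure \<alpha>) q (dunkl_hausdorff \<alpha> \<psi> \<beta> f)
        \<le> ennreal ((dunkl_A \<alpha> * V) powr t) * Lp_norm (dunkl_measure \<alpha>) p f"
    if f: "f \<in> Lp_space (dunkl_measure \<alpha>) p" for f
  proof -
    have fm: "f \<in> borel_measurable (dunkl_measure \<alpha>)" and fn: "Lp_norm (dunkl_measure \<alpha>) p f < \<infinity>"
      using f by (auto simp: Lp_space_def)
    then have "f \<in> borel_measurable lebesgue" by (simp add: dunkl_measure_def)
    then obtain g where g [measurable]: "g \<in> borel_measurable borel" and f_ae: "AE z in lborel. f z = g z"
      by (rule lebesgue_ex_borel_complex)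
    have norm_eq: "Lp_norm (dunkl_measure \<alpha>) p f = Lp_norm (dunkl_measure \<alpha>) p g"
      using fm g f_ae assms(3) alpha
      by (intro Lp_norm_cong_AE) (auto simp: AE_dunkl_iff borel_measurable_dunkl intro: order_trans[of 0 1])
    obtain G :: "real \<Rightarrow> real" where G: "\<And>x. 0 \<le> G x"
      "AE x in lborel. (\<integral>\<^sup>+z. ennreal (cmod (hausdorff_integrand \<psi>' \<beta> g x z)) \<partial>dunkl_measure \<alpha>)
         \<le> ennreal (\<bar>x\<bar> powr (2 * \<alpha> + 1) * G x)"
      "Lp_norm (dunkl_measure \<alpha>) q (\<lambda>x. complex_of_real (G x))
         \<le> ennreal ((dunkl_A \<alpha> * V) powr t) * Lp_norm (dunkl_measure \<alpha>) p g"
      using dunkl_hausdorff_majorant[OF exps psi' g V(2,1)] fn[unfolded norm_eq] by blast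
    have cong: "AE z in dunkl_measure \<alpha>. hausdorff_integrand \<psi> \<beta> f x z = hausdorff_integrand \<psi>' \<beta> g x z"
      "hausdorff_integrand \<psi> \<beta> f x \<in> borel_measurable (dunkl_measure \<alpha>)"
      "hausdorff_integrand \<psi>' \<beta> g x \<in> borel_measurable (dunkl_measure \<alpha>)" if "x \<noteq> 0" for x
    proof -
      have ae: "AE z in lborel. hausdorff_integrand \<psi> \<beta> f x z = hausdorff_integrand \<psi>' \<beta> g x z"
        using psi_ae f_ae that by (rule hausdorff_integrand_cong_AE)
      then show "AE z in dunkl_measure \<alpha>. hausdorff_integrand \<psi> \<beta> f x z = hausdorff_integrand \<psi>' \<beta> g x z"
        by (simp add: AE_dunkl_iff alpha)
      have "hausdorff_integrand \<psi> \<beta> f x \<in> borel_measurable lebesgue"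
        using ae by (rule borel_measurable_lebesgue_AE[rotated]) (simp add: measurable_completion)
      then show "hausdorff_integrand \<psi> \<beta> f x \<in> borel_measurable (dunkl_measure \<alpha>)"
        by (simp add: dunkl_measure_def)
      show "hausdorff_integrand \<psi>' \<beta> g x \<in> borel_measurable (dunkl_measure \<alpha>)"
        by (rule borel_measurable_dunkl) simp
    qed
    \<comment> \<open>The equality holds everywhere: at \<open>x = 0\<close> both sides are 0,
      because \<open>0 powr y = 0\<close> and \<open>1 / 0 = 0\<close> make the prefactor
      vanish.\<close>
    have T_eq: "dunkl_hausdorff \<alpha> \<psi> \<beta> f = dunkl_hausdorff \<alpha> \<psi>' \<beta> g"
    proof
      fix x
      show "dunkl_hausdorff \<alpha> \<psi> \<beta> f x = dunkl_hausdorff \<alpha> \<psi>' \<beta> g x"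
        unfolding dunkl_hausdorff_def
        using integral_cong_AE[OF cong(2,3,1), of x] by (cases "x = 0") auto
    qed
    have "AE x in dunkl_measure \<alpha>. integrable (dunkl_measure \<alpha>) (hausdorff_integrand \<psi> \<beta> f x)"
      unfolding AE_dunkl_iff[OF alpha] using G(2) AE_lborel_singleton[of 0]
    proof eventually_elim
      case (elim x)
      have "integrable (dunkl_measure \<alpha>) (hausdorff_integrand \<psi>' \<beta> g x)"
        using elim(1) by (intro integrable_hausdorff_integrand psi' g) (auto intro: le_less_trans)
      then show ?case
        using integrable_cong_AE[OF cong(2,3,1)] elim(2) by blast
    qed
    moreover have Tm: "dunkl_hausdorff \<alpha> \<psi>' \<beta> g \<in> borel_measurable (dunkl_measure \<alpha>)"
      by (intro borel_measurable_dunkl dunkl_hausdorff_measurable psi' g alpha)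
    moreover have "AE x in dunkl_measure \<alpha>.
        cmod (dunkl_hausdorff \<alpha> \<psi>' \<beta> g x) \<le> cmod (complex_of_real (G x))"
      unfolding AE_dunkl_iff[OF alpha] using G(2) AE_lborel_singleton[of 0]
    proof eventually_elim
      case (elim x)
      then have "cmod (dunkl_hausdorff \<alpha> \<psi>' \<beta> g x) \<le> G x"
        by (intro cmod_dunkl_hausdorff_le psi' g G(1)) auto
      then show ?case by simp
    qed
    then have "Lp_norm (dunkl_measure \<alpha>) q (dunkl_hausdorff \<alpha> \<psi>' \<beta> g)
        \<le> Lp_norm (dunkl_measure \<alpha>) q (\<lambda>x. complex_of_real (G x))"
      using Tm assms(4) by (intro Lp_norm_mono_AE) (auto intro: order_trans[of 0 1])
    ultimately show ?thesis
      unfolding T_eq norm_eq using G(3) order_trans by blast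
  qed
  have "Lp_norm (dunkl_measure \<alpha>) q (dunkl_hausdorff \<alpha> \<psi> \<beta> f) < \<infinity>"
    if "f \<in> Lp_space (dunkl_measure \<alpha>) p" for f
  proof -
    have "ennreal ((dunkl_A \<alpha> * V) powr t) * Lp_norm (dunkl_measure \<alpha>) p f < \<infinity>"
      using that by (simp add: Lp_space_def ennreal_mult_less_top)
    then show ?thesis using main[OF that] by (auto intro: le_less_trans)
  qed
  then show ?thesis
    unfolding bounded_Lp_Lq_def using main
    by (intro conjI exI[of _ "(dunkl_A \<alpha> * V) powr t"]) (auto simp: Lp_space_def)
qed

end
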